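(* The eigenspace $E_1=\{v\in\ell_1\mid L_{T,1}(v)=v\}$ of the eigenvalue $\lambda=1$ of $L_{T,1}\colon\ell_1\to\ell_1$ coincides with the closed linear span in $\ell_1$ of the vectors $u_i=\sum_{n\in\mathcal{C}_i}e_n$, where $\mathcal{C}_1,\mathcal{C}_2,\dots$ are all the cycles of the Collatz map $T$.
   Context: $\mathbb{N}^*=\{1,2,3,\dots\}$. The Collatz map $T\colon\mathbb{N}^*\to\mathbb{N}^*$ is $T(n)=n/2$ for $n$ even and $T(n)=(3n+1)/2$ for $n$ odd. $\ell_1$ has unit vectors $(e_n)_{n\in\mathbb{N}^*}$, and $L_{T,1}\colon\ell_1\to\ell_1$ is the bounded linear operator $L_{T,1}\left(\sum_n x_ne_n\right)=\sum_n x_ne_{T(n)}$. A cycle is a finite set $\mathcal{C}=\{n_1,\dots,n_k\}\subset\mathbb{N}^*$ of $k$ distinct elements with $T(n_i)=n_{i+1}$ for $i<k$ and $T(n_k)=n_1$. There are at most countably many cycles (finitely or infinitely many), enumerated as $\mathcal{C}_1,\mathcal{C}_2,\dots$. *)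

theory Defs
  imports "HOL-Analysis.Analysis"
begin

section \<open>The Banach space of absolutely summable families\<close>

typedef (overloaded) ('i, 'a :: real_normed_field) ell1 =
  "{x :: 'i \<Rightarrow> 'a. (\<lambda>i. norm (x i)) summable_on UNIV}"
  morphisms coord Abs_ell1
  by (rule exI[of _ "\<lambda>_. 0"]) simp

setup_lifting type_definition_ell1

lemma coord_abs_summable: "(\<lambda>i. norm (coord x i)) summable_on UNIV"
  using coord[of x] by simp

lemma abs_summable_on_scale:
  fixes x :: "'i \<Rightarrow> 'a :: real_normed_field"
  assumes "(\<lambda>i. norm (x i)) summable_on UNIV"
  shows "(\<lambda>i. norm (c * x i)) summable_on UNIV"
  using assms by (simp add: norm_mult summable_on_cmult_right)

lemma abs_summable_on_plus:
  fixes x y :: "'i \<Rightarrow> 'a :: real_normed_field"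
  assumes "(\<lambda>i. norm (x i)) summable_on UNIV" "(\<lambda>i. norm (y i)) summable_on UNIV"
  shows "(\<lambda>i. norm (x i + y i)) summable_on UNIV"
  by (rule summable_on_comparison_test[OF summable_on_add[OF assms]])
     (auto intro: norm_triangle_ineq)

instantiation ell1 :: (type, real_normed_field) real_normed_vector
begin

lift_definition zero_ell1 :: "('a, 'b) ell1" is "\<lambda>_. 0" by simp

lift_definition plus_ell1 :: "('a, 'b) ell1 \<Rightarrow> ('a, 'b) ell1 \<Rightarrow> ('a, 'b) ell1"
  is "\<lambda>x y i. x i + y i" by (rule abs_summable_on_plus)

lift_definition uminus_ell1 :: "('a, 'b) ell1 \<Rightarrow> ('a, 'b) ell1"
  is "\<lambda>x i. - x i" by simp

lift_definition minus_ell1 :: "('a, 'b) ell1 \<Rightarrow> ('a, 'b) ell1 \<Rightarrow> ('a, 'b) ell1"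
  is "\<lambda>x y i. x i - y i"
  using abs_summable_on_plus[of _ "\<lambda>i. - _ i"] by simp

lift_definition scaleR_ell1 :: "real \<Rightarrow> ('a, 'b) ell1 \<Rightarrow> ('a, 'b) ell1"
  is "\<lambda>c x i. c *\<^sub>R x i"
  by (simp add: summable_on_cmult_right)

lift_definition norm_ell1 :: "('a, 'b) ell1 \<Rightarrow> real"
  is "\<lambda>x. \<Sum>\<^sub>\<infinity>i. norm (x i)" .

definition "dist_ell1 (x :: ('a, 'b) ell1) y = norm (x - y)"

definition "sgn_ell1 (x :: ('a, 'b) ell1) = inverse (norm x) *\<^sub>R x"

definition uniformity_ell1 :: "(('a, 'b) ell1 \<times> ('a, 'b) ell1) filter" where
  "uniformity_ell1 = (INF e\<in>{0<..}. principal {(x, y). dist x y < e})"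

definition open_ell1 :: "('a, 'b) ell1 set \<Rightarrow> bool" where
  "open_ell1 U = (\<forall>x\<in>U. \<forall>\<^sub>F (x', y) in uniformity. x' = x \<longrightarrow> y \<in> U)"

instance
proof
  fix x y :: "('a, 'b) ell1" and a :: real
  show "norm x = 0 \<longleftrightarrow> x = 0"
  proof
    assume *: "norm x = 0"
    have "norm (coord x i) = 0" for i
      by (rule nonneg_infsum_le_0D[of "\<lambda>i. norm (coord x i)" UNIV])
         (use * coord_abs_summable[of x] in \<open>auto simp: norm_ell1.rep_eq\<close>)
    thus "x = 0" by (simp add: coord_inject[symmetric] zero_ell1.rep_eq fun_eq_iff)
  qed (simp add: norm_ell1.rep_eq zero_ell1.rep_eq)
  show "norm (x + y) \<le> norm x + norm y"
    unfolding norm_ell1.rep_eq plus_ell1.rep_eq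
    by (subst infsum_add[symmetric])
       (auto intro!: coord_abs_summable abs_summable_on_plus summable_on_add infsum_mono
             intro: norm_triangle_ineq)
  show "norm (a *\<^sub>R x) = \<bar>a\<bar> * norm x"
    by (simp add: norm_ell1.rep_eq scaleR_ell1.rep_eq infsum_cmult_right coord_abs_summable)
qed (auto simp: dist_ell1_def sgn_ell1_def uniformity_ell1_def open_ell1_def
      intro!: coord_inject[THEN iffD1]
      simp: plus_ell1.rep_eq minus_ell1.rep_eq uminus_ell1.rep_eq zero_ell1.rep_eq
        scaleR_ell1.rep_eq algebra_simps)

end

lemma norm_coord_le: "norm (coord x i) \<le> norm x"
  unfolding norm_ell1.rep_eq
  using finite_sum_le_infsum[OF coord_abs_summable[of x], of "{i}"] by simp

instance ell1 :: (type, "{real_normed_field, banach}") banach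
proof
  fix X :: "nat \<Rightarrow> ('a, 'b) ell1"
  assume X: "Cauchy X"
  have "Cauchy (\<lambda>n. coord (X n) i)" for i
  proof (rule CauchyI)
    fix e :: real assume "e > 0"
    then obtain M where M: "\<forall>m\<ge>M. \<forall>n\<ge>M. norm (X m - X n) < e"
      using CauchyD[OF X] by blast
    have "norm (coord (X m) i - coord (X n) i) < e" if "m \<ge> M" "n \<ge> M" for m n
      using le_less_trans[OF norm_coord_le[of "X m - X n" i]] M that
      by (simp add: minus_ell1.rep_eq)
    thus "\<exists>M. \<forall>m\<ge>M. \<forall>n\<ge>M. norm (coord (X m) i - coord (X n) i) < e" by blast
  qed
  hence "\<exists>l. (\<lambda>n. coord (X n) i) \<longlonglongrightarrow> l" for i
    using Cauchy_convergent convergent_def by blast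
  hence "\<exists>y. \<forall>i. (\<lambda>n. coord (X n) i) \<longlonglongrightarrow> y i" by (intro choice allI)
  then obtain y where y: "\<And>i. (\<lambda>n. coord (X n) i) \<longlonglongrightarrow> y i" by blast
  have fin: "(\<Sum>i\<in>F. norm (coord (X m) i - y i)) \<le> e"
    if "finite F" "m \<ge> M" and M: "\<forall>m\<ge>M. \<forall>n\<ge>M. norm (X m - X n) < e" for F e m M
  proof (rule LIMSEQ_le_const2)
    show "(\<lambda>n. \<Sum>i\<in>F. norm (coord (X m) i - coord (X n) i)) \<longlonglongrightarrow> (\<Sum>i\<in>F. norm (coord (X m) i - y i))"
      by (intro tendsto_intros y)
    have "(\<Sum>i\<in>F. norm (coord (X m) i - coord (X n) i)) \<le> e" if "n \<ge> M" for n
    proof -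
      have "(\<Sum>i\<in>F. norm (coord (X m - X n) i)) \<le> norm (X m - X n)"
        unfolding norm_ell1.rep_eq
        by (rule finite_sum_le_infsum[OF coord_abs_summable \<open>finite F\<close>]) auto
      also have "\<dots> \<le> e" using M \<open>m \<ge> M\<close> that by (simp add: less_imp_le)
      finally show ?thesis by (simp add: minus_ell1.rep_eq)
    qed
    thus "\<exists>N. \<forall>n\<ge>N. (\<Sum>i\<in>F. norm (coord (X m) i - coord (X n) i)) \<le> e" by blast
  qed
  have sm: "(\<lambda>i. norm (coord (X m) i - y i)) summable_on UNIV \<and> (\<Sum>\<^sub>\<infinity>i. norm (coord (X m) i - y i)) \<le> e"
    if "m \<ge> M" and M: "\<forall>m\<ge>M. \<forall>n\<ge>M. norm (X m - X n) < e" for e m M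
  proof
    show *: "(\<lambda>i. norm (coord (X m) i - y i)) summable_on UNIV"
      by (intro nonneg_bdd_above_summable_on bdd_aboveI2[where M = e] fin[OF _ that]) simp_all
    show "(\<Sum>\<^sub>\<infinity>i. norm (coord (X m) i - y i)) \<le> e"
      by (rule infsum_le_finite_sums[OF *]) (rule fin[OF _ that])
  qed
  obtain M where M: "\<forall>m\<ge>M. \<forall>n\<ge>M. norm (X m - X n) < 1"
    using CauchyD[OF X, of 1] by auto
  have "(\<lambda>i. norm (coord (X M) i - y i)) summable_on UNIV" using sm[OF order_refl M] by simp
  hence "(\<lambda>i. norm (y i - coord (X M) i)) summable_on UNIV" by (simp add: norm_minus_commute)
  from abs_summable_on_plus[OF this coord_abs_summable[of "X M"]]
  have ysum: "(\<lambda>i. norm (y i)) summable_on UNIV" by simp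
  define Y where "Y = Abs_ell1 y"
  have cY: "coord Y = y" unfolding Y_def by (rule Abs_ell1_inverse) (use ysum in simp)
  have "X \<longlonglongrightarrow> Y"
  proof (rule LIMSEQ_I)
    fix r :: real assume r: "r > 0"
    then obtain M where M: "\<forall>m\<ge>M. \<forall>n\<ge>M. norm (X m - X n) < r/2"
      using CauchyD[OF X, of "r/2"] by auto
    have "norm (X n - Y) < r" if "n \<ge> M" for n
      using sm[OF that M] r by (simp add: norm_ell1.rep_eq minus_ell1.rep_eq cY)
    thus "\<exists>M. \<forall>n\<ge>M. norm (X n - Y) < r" by blast
  qed
  thus "convergent X" by (auto simp: convergent_def)
qed

text \<open>The type class only provides multiplication by real scalars; linear spans are to be
  taken over the whole scalar field, which may be \<open>\<real>\<close> or \<open>\<complex>\<close>.\<close>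

lift_definition scale_ell1 :: "'a \<Rightarrow> ('i, 'a :: real_normed_field) ell1 \<Rightarrow> ('i, 'a) ell1"
    (infixr "*\<^sub>K" 75)
  is "\<lambda>c x i. c * x i" by (rule abs_summable_on_scale)

interpretation ell1: vector_space "(*\<^sub>K) :: 'a :: real_normed_field \<Rightarrow> ('i, 'a) ell1 \<Rightarrow> _"
  by unfold_locales (transfer; simp add: algebra_simps)+

lift_definition unit_vec :: "'i \<Rightarrow> ('i, 'a :: real_normed_field) ell1"
  is "\<lambda>n m. if m = n then 1 else 0"
proof -
  fix n :: 'i
  show "(\<lambda>m. norm (if m = n then 1 else 0 :: 'a)) summable_on UNIV"
    by (rule summable_on_cong_neutral[THEN iffD1, OF _ _ _ summable_on_finite[of "{n}" "\<lambda>_. 1"]]) auto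
qed

lemma scaleR_scale_ell1: "(r *\<^sub>R c) *\<^sub>K x = r *\<^sub>R (c *\<^sub>K x)"
  by transfer simp

lemma norm_scale_ell1: "norm (c *\<^sub>K x) = norm c * norm x"
  by (simp add: norm_ell1.rep_eq scale_ell1.rep_eq norm_mult infsum_cmult_right coord_abs_summable)

lemma norm_unit_vec: "norm (unit_vec n :: ('i, 'a :: real_normed_field) ell1) = 1"
proof -
  have "(\<Sum>\<^sub>\<infinity>m. norm (if m = n then 1 else 0 :: 'a)) = (\<Sum>\<^sub>\<infinity>m\<in>{n}. 1)"
    by (rule infsum_cong_neutral) auto
  thus ?thesis by (simp add: norm_ell1.rep_eq unit_vec.rep_eq)
qed


section \<open>The Collatz map\<close>

typedef pnat = "{n :: nat. n > 0}"
  morphisms nat_of_pnat pnat_of_nat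
  by auto

setup_lifting type_definition_pnat

lift_definition collatz :: "pnat \<Rightarrow> pnat"
  is "\<lambda>n. if even n then n div 2 else (3 * n + 1) div 2"
  by (auto elim!: evenE oddE)

definition is_cycle :: "pnat set \<Rightarrow> bool" where
  "is_cycle C \<longleftrightarrow> (\<exists>(k :: nat) n. k \<ge> 1 \<and> inj_on n {1..k} \<and> C = n ` {1..k} \<and>
     (\<forall>i. 1 \<le> i \<and> i < k \<longrightarrow> collatz (n i) = n (i + 1)) \<and> collatz (n k) = n 1)"


section \<open>The Collatz operator\<close>

definition collatz_op :: "(pnat, 'a) ell1 \<Rightarrow> (pnat, 'a :: {real_normed_field, banach}) ell1" where
  "collatz_op x = (\<Sum>\<^sub>\<infinity>n. coord x n *\<^sub>K unit_vec (collatz n))"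

lemma collatz_op_abs_summable:
  fixes x :: "(pnat, 'a :: {real_normed_field, banach}) ell1"
  shows "(\<lambda>n. norm (coord x n *\<^sub>K unit_vec (collatz n))) summable_on UNIV"
  by (simp add: norm_scale_ell1 norm_unit_vec coord_abs_summable)

lemma bounded_linear_collatz_op:
  "bounded_linear (collatz_op :: (pnat, 'a :: {real_normed_field, banach}) ell1 \<Rightarrow> _)"
proof (rule bounded_linear_intro[where K=1])
  fix x y :: "(pnat, 'a) ell1" and r :: real
  note S = abs_summable_summable[OF collatz_op_abs_summable]
  show "collatz_op (x + y) = collatz_op x + collatz_op y"
    by (simp add: collatz_op_def plus_ell1.rep_eq ell1.scale_left_distrib infsum_add S)
  show "collatz_op (r *\<^sub>R x) = r *\<^sub>R collatz_op x"
    by (simp add: collatz_op_def scaleR_ell1.rep_eq scaleR_scale_ell1 infsum_scaleR_right)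
  show "norm (collatz_op x) \<le> norm x * 1"
    using norm_infsum_bound[OF collatz_op_abs_summable[of x]]
    by (simp add: collatz_op_def norm_scale_ell1 norm_unit_vec norm_ell1.rep_eq[of x])
qed

lemma collatz_op_unit_vec:
  "collatz_op (unit_vec n) = unit_vec (collatz n)"
proof -
  have "collatz_op (unit_vec n) = (\<Sum>\<^sub>\<infinity>m\<in>{n}. unit_vec (collatz m))"
    unfolding collatz_op_def
    by (rule infsum_cong_neutral) (auto simp: unit_vec.rep_eq)
  thus ?thesis by simp
qed

definition cycle_vec :: "pnat set \<Rightarrow> (pnat, 'a :: {real_normed_field, banach}) ell1" where
  "cycle_vec C = (\<Sum>n\<in>C. unit_vec n)"

end

theory Submission
  imports Defs
begin

text \<open>
  In coordinates, the operator pushes \<open>v\<close> forward: the value at \<open>m\<close> becomes the sum of \<open>v\<close> over the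
  fibre \<open>T\<^sup>-\<^sup>1(m)\<close> (\<open>coord_collatz_op\<close>). Cycles are permuted by \<open>T\<close>, so their indicator vectors
  are fixed, and the fixed space is closed. The content lies in the other inclusion.

  Let \<open>v\<close> be fixed. The triangle inequality gives \<open>\<bar>v(m)\<bar> \<le> \<Sum>\<^sub>T\<^sub>n\<^sub>=\<^sub>m \<bar>v(n)\<bar>\<close> for every \<open>m\<close>; summed over
  all \<open>m\<close>, both sides have the same finite total \<open>\<parallel>v\<parallel>\<close>, so no inequality is strict and \<open>\<bar>v\<bar>\<close> is
  the density of a finite \<open>T\<close>-invariant measure (\<open>infsum_norm_vimage_eq\<close>). Hence \<open>\<bar>v\<bar>\<close> never decreases along
  orbits, and each level set \<open>S = {n. \<bar>v(n)\<bar> \<ge> c}\<close> with \<open>c > 0\<close> is finite and mapped into itself.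
  Invariance says that \<open>S\<close> and \<open>T\<^sup>-\<^sup>1(S)\<close> have the same mass, so \<open>v\<close> vanishes at all points that
  enter \<open>S\<close> from outside. As \<open>v\<close> is nonzero on \<open>S\<close>, every point of \<open>S\<close> then has a preimage in \<open>S\<close>:
  \<open>T\<close> permutes the finite set \<open>S\<close>, and \<open>v(Tn) = v(n)\<close> on it (\<open>level_set_of_invariant\<close>).

  So \<open>S\<close> is a disjoint union of finitely many cycles on each of which \<open>v\<close> is constant, and the
  truncation of \<open>v\<close> to \<open>S\<close> is a linear combination of cycle vectors
  (\<open>sum_over_permuted_set_in_span_cycle_vec\<close>). As \<open>c\<close> tends to \<open>0\<close> these truncations converge
  to \<open>v\<close> in norm (\<open>level_set_truncation_close\<close>).
\<close>

section \<open>Summable functions that are invariant under pushing forward\<close>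

lemma finite_level_set_of_summable:
  fixes f :: "'i \<Rightarrow> real"
  assumes "f summable_on UNIV" "c > 0"
  shows "finite {n. f n \<ge> c}"
proof (rule ccontr)
  assume inf: "infinite {n. f n \<ge> c}"
  have "(\<lambda>_. c) summable_on {n. f n \<ge> c}"
    by (rule summable_on_comparison_test[OF summable_on_subset_banach[OF assms(1) subset_UNIV]])
       (use assms(2) in auto)
  with infsum_diverge_constant[OF inf, of c] assms(2) show False by simp
qed

lemma has_sum_over_fibres:
  fixes f :: "'i \<Rightarrow> 'b :: banach"
  assumes "f summable_on UNIV"
  shows "((\<lambda>m. infsum f (T -` {m})) has_sum infsum f (T -` A)) A"
proof -
  have bij: "bij_betw snd (Sigma A (\<lambda>m. T -` {m})) (T -` A)"
    by (rule bij_betwI[of _ _ _ "\<lambda>n. (T n, n)"]) auto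
  have "(f has_sum infsum f (T -` A)) (T -` A)"
    using summable_on_subset_banach[OF assms subset_UNIV] by (rule has_sum_infsum)
  hence "((\<lambda>p. f (snd p)) has_sum infsum f (T -` A)) (Sigma A (\<lambda>m. T -` {m}))"
    by (subst has_sum_reindex_bij_betw[OF bij])
  thus ?thesis
  proof (rule has_sum_SigmaD)
    show "((\<lambda>y. f (snd (m, y))) has_sum infsum f (T -` {m})) (T -` {m})" for m
      using has_sum_infsum[OF summable_on_subset_banach[OF assms subset_UNIV]] by simp
  qed
qed

text \<open>The triangle inequality gives \<open>\<ge>\<close> for every \<open>A\<close>. Applied to \<open>A\<close> and to its complement,
  whose masses add up to the finite total on both sides, it forces equality.\<close>

lemma infsum_norm_vimage_eq:
  fixes v :: "'i \<Rightarrow> 'b :: banach"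
  assumes sm: "(\<lambda>n. norm (v n)) summable_on UNIV"
    and fixed: "\<And>m. v m = infsum v (T -` {m})"
  shows "(\<Sum>\<^sub>\<infinity>n\<in>T -` A. norm (v n)) = (\<Sum>\<^sub>\<infinity>n\<in>A. norm (v n))"
proof -
  let ?w = "\<lambda>n. norm (v n)"
  note sub = summable_on_subset_banach[OF sm subset_UNIV]
  have le: "infsum ?w B \<le> infsum ?w (T -` B)" for B
  proof (rule has_sum_mono[OF has_sum_infsum[OF sub] has_sum_over_fibres[OF sm]])
    show "?w m \<le> infsum ?w (T -` {m})" for m
      by (subst fixed) (rule norm_infsum_bound[OF sub])
  qed
  have split: "infsum ?w UNIV = infsum ?w B + infsum ?w (- B)" for B
    using infsum_Un_disjoint[OF sub[of B] sub[of "- B"]] by simp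
  have "T -` (- A) = - (T -` A)" by auto
  with le[of A] le[of "- A"] split[of A] split[of "T -` A"] show ?thesis by simp
qed

text \<open>If \<open>v\<close> were nonzero at a point that enters \<open>S\<close> from outside, then \<open>T -` S\<close> would have larger
  mass than \<open>S\<close>. So the fixed-point equation at a point of the level set involves preimages in
  the level set only; there must be one since \<open>v\<close> is nonzero there, and only one since a surjection of a finite set
  onto itself is injective.\<close>

lemma level_set_of_invariant:
  fixes v :: "'i \<Rightarrow> 'b :: banach"
  assumes sm: "(\<lambda>n. norm (v n)) summable_on UNIV"
    and fixed: "\<And>m. v m = infsum v (T -` {m})"
    and c: "c > 0" and S_def: "S = {n. norm (v n) \<ge> c}"
  shows "finite S" "bij_betw T S S" "\<And>n. n \<in> S \<Longrightarrow> v (T n) = v n"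
proof -
  let ?w = "\<lambda>n. norm (v n)"
  note sub = summable_on_subset_banach[OF sm subset_UNIV]
  note mass = infsum_norm_vimage_eq[OF sm fixed]
  show fin: "finite S"
    using finite_level_set_of_summable[OF sm c] by (simp add: S_def)
  have mono: "?w n \<le> ?w (T n)" for n
    using infsum_mono2[OF sub[of "{n}"] sub[of "T -` {T n}"]] mass[of "{T n}"] by simp
  have T_S: "T n \<in> S" if "n \<in> S" for n
    using mono[of n] that by (simp add: S_def)
  have leak: "v n = 0" if "n \<notin> S" "T n \<in> S" for n
  proof -
    have "S \<union> (T -` S - S) = T -` S" using T_S by auto
    hence "infsum ?w (T -` S) = infsum ?w S + infsum ?w (T -` S - S)"
      using infsum_Un_disjoint[OF sub[of S] sub[of "T -` S - S"]] by auto
    hence "infsum ?w (T -` S - S) \<le> 0" using mass[of S] by simp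
    hence "?w n = 0" by (rule nonneg_infsum_le_0D[OF _ sub]) (use that in auto)
    thus ?thesis by simp
  qed
  have v_eq: "v m = (\<Sum>n | n \<in> S \<and> T n = m. v n)" if "m \<in> S" for m
  proof -
    have "infsum v (T -` {m}) = infsum v {n. n \<in> S \<and> T n = m}"
      by (rule infsum_cong_neutral) (use leak that in auto)
    with fixed[of m] fin show ?thesis by simp
  qed
  have "m \<in> T ` S" if "m \<in> S" for m
  proof (rule ccontr)
    assume "m \<notin> T ` S"
    hence "{n. n \<in> S \<and> T n = m} = {}" by auto
    with v_eq[OF that] have "v m = 0" by (simp only: sum.empty)
    with that c show False by (simp add: S_def)
  qed
  hence surj: "T ` S = S" using T_S by auto
  hence inj: "inj_on T S" using fin by (intro eq_card_imp_inj_on) simp_all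
  show "bij_betw T S S" using inj surj by (simp add: bij_betw_def)
  show "v (T n) = v n" if "n \<in> S" for n
  proof -
    have "{k. k \<in> S \<and> T k = T n} = {n}" using inj that by (auto dest: inj_onD)
    with v_eq[OF T_S[OF that]] show ?thesis by simp
  qed
qed

section \<open>Cycles\<close>

lemma is_cycle_bij_betw:
  assumes "is_cycle C"
  shows "finite C" "bij_betw collatz C C"
proof -
  obtain k :: nat and n where k: "k \<ge> 1" and C: "C = n ` {1..k}"
    and step: "\<forall>i. 1 \<le> i \<and> i < k \<longrightarrow> collatz (n i) = n (i + 1)" and last: "collatz (n k) = n 1"
    using assms unfolding is_cycle_def by blast
  show fin: "finite C" using C by simp
  have "n i \<in> collatz ` C" if "1 \<le> i" "i \<le> k" for i
  proof (cases "i = 1")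
    case True
    have "n k \<in> C" using k by (auto simp: C)
    with True last show ?thesis by (metis imageI)
  next
    case False
    hence i: "1 \<le> i - 1" "i - 1 < k" "i - 1 + 1 = i" using that by auto
    hence "n (i - 1) \<in> C" by (auto simp: C)
    moreover have "collatz (n (i - 1)) = n i" using step i by metis
    ultimately show ?thesis by (metis imageI)
  qed
  hence "C \<subseteq> collatz ` C" unfolding C by auto
  moreover have "card (collatz ` C) \<le> card C" by (rule card_image_le[OF fin])
  ultimately have "collatz ` C = C" using fin by (metis card_seteq finite_imageI)
  moreover from this have "inj_on collatz C" using fin by (intro eq_card_imp_inj_on) simp_all
  ultimately show "bij_betw collatz C C" by (simp add: bij_betw_def)
qed

text \<open>Two iterates of \<open>n\<close> coincide because \<open>S\<close> is finite, and \<open>n\<close> itself recurs because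
  powers of a permutation can be cancelled. The cycle consists of the iterates up to the first
  return time. That its points are iterates of \<open>n\<close> makes a function that is invariant
  along \<open>collatz\<close> constant on it.\<close>

lemma finite_permuted_set_contains_cycle:
  assumes fin: "finite S" and bij: "bij_betw collatz S S" and n: "n \<in> S"
  obtains C where "is_cycle C" "C \<subseteq> S" "n \<in> C" "\<And>m. m \<in> C \<Longrightarrow> \<exists>i. m = (collatz ^^ i) n"
proof -
  let ?it = "\<lambda>i. (collatz ^^ i) n"
  have bij_it: "bij_betw (collatz ^^ i) S S" for i using bij_betw_funpow[OF bij] .
  have it_S: "?it i \<in> S" for i using bij_it[of i] n by (auto dest: bij_betwE)
  have "range ?it \<subseteq> S" using it_S by auto
  hence "finite (range ?it)" using fin finite_subset by blast
  hence "\<not> inj ?it" using finite_imageD by blast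
  then obtain i j where "?it i = ?it j" "i < j" by (metis injI linorder_neqE_nat)
  hence "(collatz ^^ i) n = (collatz ^^ i) (?it (j - i))"
    by (metis add_diff_inverse_nat comp_apply funpow_add not_less_iff_gr_or_eq)
  with bij_it[of i] n it_S have "?it (j - i) = n" by (metis bij_betw_def inj_onD)
  with \<open>i < j\<close> have ex: "\<exists>k>0. ?it k = n" by (metis zero_less_diff)
  define k where "k = (LEAST k. k > 0 \<and> ?it k = n)"
  have k: "k > 0" "?it k = n" using LeastI_ex[OF ex] by (auto simp: k_def)
  have k_le: "k \<le> j" if "j > 0" "?it j = n" for j
    unfolding k_def by (rule Least_le) (use that in auto)
  \<comment> \<open>If iterates \<open>i < j\<close> agreed, applying \<open>k - j\<close> further steps to both would bring \<open>n\<close> back to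
    itself after \<open>k - j + i < k\<close> steps.\<close>
  have "i = j" if ij: "1 \<le> i" "i \<le> j" "j \<le> k" "?it i = ?it j" for i j
  proof -
    have "?it (k - j + i) = ?it (k - j + j)" using ij(4) by (simp add: funpow_add)
    also have "\<dots> = n" using k ij by simp
    finally have "k \<le> k - j + i" by (intro k_le) (use ij in auto)
    with ij show "i = j" by linarith
  qed
  hence inj: "inj_on ?it {1..k}"
    by (intro inj_onI) (metis atLeastAtMost_iff nle_le)
  show thesis
  proof (rule that)
    show "is_cycle (?it ` {1..k})"
      unfolding is_cycle_def
      by (rule exI[of _ k], rule exI[of _ ?it]) (use k inj in auto)
    show "n \<in> ?it ` {1..k}" using k by (intro image_eqI[of _ _ k]) auto
  qed (use it_S in auto)
qed

section \<open>Vectors supported on finite unions of cycles\<close>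

text \<open>By induction on \<open>S\<close>, splitting off one cycle at a time: what is left is again permuted, and on
  the cycle itself the sum is a multiple of the cycle vector.\<close>

lemma sum_over_permuted_set_in_span_cycle_vec:
  fixes v :: "pnat \<Rightarrow> 'a :: {real_normed_field, banach}"
  assumes "finite S" "bij_betw collatz S S" "\<And>n. n \<in> S \<Longrightarrow> v (collatz n) = v n"
  shows "(\<Sum>n\<in>S. v n *\<^sub>K unit_vec n) \<in> ell1.span (cycle_vec ` {C. is_cycle C})"
  using assms
proof (induction S rule: finite_psubset_induct)
  case (psubset S)
  show ?case
  proof (cases "S = {}")
    case True
    thus ?thesis by (simp add: ell1.span_zero)
  next
    case False
    then obtain n where n: "n \<in> S" by blast
    obtain C where C: "is_cycle C" "C \<subseteq> S" "n \<in> C" "\<And>m. m \<in> C \<Longrightarrow> \<exists>i. m = (collatz ^^ i) n"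
      using finite_permuted_set_contains_cycle[OF psubset.hyps psubset.prems(1) n] by blast
    have orbit: "(collatz ^^ i) n \<in> S \<and> v ((collatz ^^ i) n) = v n" for i
      by (induction i) (use n psubset.prems in \<open>auto dest: bij_betwE\<close>)
    have const: "v m = v n" if "m \<in> C" for m using C(4)[OF that] orbit by auto
    have "(\<Sum>m\<in>C. v m *\<^sub>K unit_vec m) = (\<Sum>m\<in>C. v n *\<^sub>K (unit_vec m :: (pnat, 'a) ell1))"
      by (intro sum.cong refl) (simp add: const)
    also have "\<dots> = v n *\<^sub>K cycle_vec C"
      by (simp add: cycle_vec_def ell1.scale_sum_right)
    finally have on_C: "(\<Sum>m\<in>C. v m *\<^sub>K unit_vec m) = v n *\<^sub>K cycle_vec C" .
    have "bij_betw collatz (S - C) (S - C)"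
      using bij_betw_DiffI[OF psubset.prems(1) is_cycle_bij_betw(2)[OF C(1)] C(2) C(2)] .
    hence "(\<Sum>m\<in>S - C. v m *\<^sub>K unit_vec m) \<in> ell1.span (cycle_vec ` {C. is_cycle C})"
      using C n psubset.prems(2) by (intro psubset.IH) auto
    moreover have "v n *\<^sub>K cycle_vec C \<in> ell1.span (cycle_vec ` {C. is_cycle C})"
      using C(1) by (intro ell1.span_scale ell1.span_base) auto
    ultimately show ?thesis
      by (subst sum.subset_diff[OF C(2) psubset.hyps(1)]) (simp add: on_C ell1.span_add)
  qed
qed

lemma coord_eqI: "(\<And>i. coord x i = coord y i) \<Longrightarrow> x = y"
  by (simp add: coord_inject[symmetric] fun_eq_iff)

lemma coord_sum: "coord (\<Sum>n\<in>S. f n) m = (\<Sum>n\<in>S. coord (f n) m)"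
  by (induction S rule: infinite_finite_induct) (simp_all add: zero_ell1.rep_eq plus_ell1.rep_eq)

text \<open>A finite set carries all but \<open>e / 2\<close> of the norm; a level not above the smallest nonzero modulus
  attained on that set leaves out only points of it where \<open>v\<close> vanishes.\<close>

lemma level_set_truncation_close:
  fixes v :: "('i, 'a :: real_normed_field) ell1"
  assumes e: "e > 0"
  obtains c where "c > 0"
    "norm (v - (\<Sum>n | norm (coord v n) \<ge> c. coord v n *\<^sub>K unit_vec n)) < e"
proof -
  let ?w = "\<lambda>n. norm (coord v n)"
  note sm = coord_abs_summable[of v]
  note sub = summable_on_subset_banach[OF sm subset_UNIV]
  obtain F where F: "finite F" "dist (sum ?w F) (infsum ?w UNIV) \<le> e / 2"
    using infsum_finite_approximation[OF sm, of "e / 2"] e by auto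
  \<comment> \<open>The entry \<open>1\<close> only keeps the minimum defined when \<open>v\<close> vanishes on \<open>F\<close>.\<close>
  define c where "c = Min (insert 1 (?w ` {n \<in> F. ?w n \<noteq> 0}))"
  have c: "c > 0" unfolding c_def using F(1) by (subst Min_gr_iff) auto
  define S where "S = {n. ?w n \<ge> c}"
  have F_S: "?w n = 0" if "n \<in> F" "n \<notin> S" for n
  proof (rule ccontr)
    assume "?w n \<noteq> 0"
    hence "c \<le> ?w n" unfolding c_def using that(1) F(1) by (intro Min_le) auto
    with that(2) show False by (simp add: S_def)
  qed
  have fin: "finite S"
    using finite_level_set_of_summable[OF sm c] by (simp add: S_def)
  have coord_trunc: "coord (\<Sum>n\<in>S. coord v n *\<^sub>K unit_vec n) m = (if m \<in> S then coord v m else 0)" for m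
    using fin by (simp add: coord_sum scale_ell1.rep_eq unit_vec.rep_eq if_distrib cong: if_cong)
  have "norm (v - (\<Sum>n\<in>S. coord v n *\<^sub>K unit_vec n)) = infsum ?w (- S)"
    unfolding norm_ell1.rep_eq minus_ell1.rep_eq coord_trunc
    by (rule infsum_cong_neutral) auto
  also have "\<dots> = infsum ?w UNIV - sum ?w S"
    using infsum_Un_disjoint[OF sub[of S] sub[of "- S"]] fin by simp
  also have "\<dots> \<le> infsum ?w UNIV - sum ?w F"
  proof -
    have "sum ?w F = sum ?w (F \<inter> S)"
      by (rule sum.mono_neutral_right) (use F F_S in auto)
    also have "\<dots> \<le> sum ?w S" by (rule sum_mono2) (use fin in auto)
    finally show ?thesis by simp
  qed
  also have "\<dots> < e" using F(2) e unfolding dist_real_def by linarith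
  finally show thesis using that c unfolding S_def by blast
qed

section \<open>The fixed space of the Collatz operator\<close>

lemma coord_collatz_op:
  fixes x :: "(pnat, 'a :: {real_normed_field, banach}) ell1"
  shows "coord (collatz_op x) m = infsum (coord x) (collatz -` {m})"
proof -
  have "bounded_linear (\<lambda>y :: (pnat, 'a) ell1. coord y m)"
    by (rule bounded_linear_intro[where K = 1])
       (auto simp: plus_ell1.rep_eq scaleR_ell1.rep_eq norm_coord_le)
  from infsumI[OF has_sum_bounded_linear[OF this
      has_sum_infsum[OF abs_summable_summable[OF collatz_op_abs_summable[of x]]]], symmetric]
  have "coord (collatz_op x) m
      = (\<Sum>\<^sub>\<infinity>n. coord x n * (if m = collatz n then 1 else 0))"
    by (simp add: collatz_op_def o_def scale_ell1.rep_eq unit_vec.rep_eq)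
  also have "\<dots> = infsum (coord x) (collatz -` {m})"
    by (rule infsum_cong_neutral) auto
  finally show ?thesis .
qed

lemma subspace_fixed_collatz_op:
  "ell1.subspace {v :: (pnat, 'a :: {real_normed_field, banach}) ell1. collatz_op v = v}"
proof (rule ell1.subspaceI)
  interpret L: bounded_linear "collatz_op :: (pnat, 'a) ell1 \<Rightarrow> _"
    by (rule bounded_linear_collatz_op)
  show "0 \<in> {v :: (pnat, 'a) ell1. collatz_op v = v}" by (simp add: L.zero)
  show "x + y \<in> {v. collatz_op v = v}"
    if "x \<in> {v. collatz_op v = v}" "y \<in> {v. collatz_op v = v}" for x y :: "(pnat, 'a) ell1"
    using that by (simp add: L.add)
  show "c *\<^sub>K x \<in> {v. collatz_op v = v}"
    if "x \<in> {v. collatz_op v = v}" for c and x :: "(pnat, 'a) ell1"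
  proof -
    have "collatz_op (c *\<^sub>K x) = c *\<^sub>K collatz_op x"
      by (rule coord_eqI) (simp add: coord_collatz_op scale_ell1.rep_eq infsum_cmult_right')
    with that show ?thesis by simp
  qed
qed

lemma collatz_op_cycle_vec:
  assumes "is_cycle C"
  shows "collatz_op (cycle_vec C) = (cycle_vec C :: (pnat, 'a :: {real_normed_field, banach}) ell1)"
proof -
  interpret L: bounded_linear "collatz_op :: (pnat, 'a) ell1 \<Rightarrow> _"
    by (rule bounded_linear_collatz_op)
  have "collatz_op (cycle_vec C) = (\<Sum>n\<in>C. unit_vec (collatz n) :: (pnat, 'a) ell1)"
    by (simp add: cycle_vec_def L.sum collatz_op_unit_vec)
  also have "\<dots> = cycle_vec C"
    unfolding cycle_vec_def by (rule sum.reindex_bij_betw[OF is_cycle_bij_betw(2)[OF assms]])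
  finally show ?thesis .
qed

theorem theorem6p7:
  shows "{v :: (pnat, 'a :: {real_normed_field, banach}) ell1. collatz_op v = v} =
    closure (ell1.span (cycle_vec ` {C. is_cycle C}))"
proof (rule equalityI)
  show "{v :: (pnat, 'a) ell1. collatz_op v = v} \<subseteq> closure (ell1.span (cycle_vec ` {C. is_cycle C}))"
  proof clarify
    fix v :: "(pnat, 'a) ell1"
    assume v: "collatz_op v = v"
    hence fixed: "coord v m = infsum (coord v) (collatz -` {m})" for m
      by (metis coord_collatz_op)
    show "v \<in> closure (ell1.span (cycle_vec ` {C. is_cycle C}))"
      unfolding closure_approachable
    proof (intro allI impI)
      fix e :: real
      assume "e > 0"
      then obtain c where c: "c > 0"
        and close: "norm (v - (\<Sum>n | norm (coord v n) \<ge> c. coord v n *\<^sub>K unit_vec n)) < e"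
        by (rule level_set_truncation_close)
      note level = level_set_of_invariant[OF coord_abs_summable fixed c refl]
      have "(\<Sum>n | norm (coord v n) \<ge> c. coord v n *\<^sub>K unit_vec n)
          \<in> ell1.span (cycle_vec ` {C. is_cycle C})"
        by (rule sum_over_permuted_set_in_span_cycle_vec[where v = "coord v"]) (fact level)+
      with close show "\<exists>y\<in>ell1.span (cycle_vec ` {C. is_cycle C}). dist y v < e"
        by (metis dist_commute dist_norm)
    qed
  qed
  show "closure (ell1.span (cycle_vec ` {C. is_cycle C})) \<subseteq> {v :: (pnat, 'a) ell1. collatz_op v = v}"
  proof (rule closure_minimal)
    show "ell1.span (cycle_vec ` {C. is_cycle C}) \<subseteq> {v :: (pnat, 'a) ell1. collatz_op v = v}"
      by (rule ell1.span_minimal[OF _ subspace_fixed_collatz_op]) (auto simp: collatz_op_cycle_vec)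
    show "closed {v :: (pnat, 'a) ell1. collatz_op v = v}"
      by (intro closed_Collect_eq continuous_on_id
          linear_continuous_on[OF bounded_linear_collatz_op])
  qed
qed

end
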